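(* Let $M$ be a von Neumann algebra with a faithful normal state $\varphi_\rho$, let $N_t\subseteq M$ be an abelian von Neumann subalgebra, and let $E_t:M\to N_t$ be a normal $\varphi_\rho$-preserving conditional expectation. Let $L^2(N_t,\varphi_\rho)$ be the closed subspace of $L^2(M,\varphi_\rho)$ generated by $N_t$. Then the unique bounded extension of $E_t$ to $L^2(M,\varphi_\rho)$ is the orthogonal projection of $L^2(M,\varphi_\rho)$ onto $L^2(N_t,\varphi_\rho)$. In particular, for all $X\in L^2(M,\varphi_\rho)$ and $A\in L^2(N_t,\varphi_\rho)$, $$\langle X-E_t(X),A\rangle_{\varphi_\rho}=0 .$$
   Context: For $X,Y\in M$, $\langle X,Y\rangle_{\varphi_\rho}:=\varphi_\rho(X^*Y)$ and $\|X\|_2:=\varphi_\rho(X^*X)^{1/2}$; $L^2(M,\varphi_\rho)$ is the Hilbert space completion of $M$ in $\|\cdot\|_2$. A conditional expectation $E:M\to N$ is a unital completely positive idempotent map onto $N$ that is $N$-bimodular, $E(aXb)=aE(X)b$ for $a,b\in N$; it is $\varphi_\rho$-preserving if $\varphi_\rho\circ E=\varphi_\rho$. Such an $E_t$ is contractive for $\|\cdot\|_2$ on $M$, so it extends uniquely to a bounded operator on $L^2(M,\varphi_\rho)$, still denoted $E_t$. *)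

theory Defs
  imports "HOL-Analysis.Analysis"
begin

section \<open>Complex vector spaces and complex Hilbert spaces\<close>

class complex_vector = real_vector +
  fixes scaleC :: "complex \<Rightarrow> 'a \<Rightarrow> 'a"  (infixr \<open>*\<^sub>C\<close> 75)
  assumes scaleC_add_right: "c *\<^sub>C (x + y) = c *\<^sub>C x + c *\<^sub>C y"
    and scaleC_add_left: "(c + d) *\<^sub>C x = c *\<^sub>C x + d *\<^sub>C x"
    and scaleC_scaleC: "c *\<^sub>C d *\<^sub>C x = (c * d) *\<^sub>C x"
    and scaleC_of_real: "complex_of_real r *\<^sub>C x = r *\<^sub>R x"

text \<open>The inner product \<open>cinner\<close> is conjugate-linear in the first and linear in the second
  argument. Its real part is the library's real inner product \<open>inner\<close>; this gives positive
  definiteness and makes the library norm and topology those of \<open>cinner\<close>.\<close>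

class complex_hilbert_space = complex_vector + real_inner + complete_space +
  fixes cinner :: "'a \<Rightarrow> 'a \<Rightarrow> complex"
  assumes cinner_commute: "cinner x y = cnj (cinner y x)"
    and cinner_add_right: "cinner x (y + z) = cinner x y + cinner x z"
    and cinner_scaleC_right: "cinner x (c *\<^sub>C y) = c * cinner x y"
    and Re_cinner: "Re (cinner x y) = inner x y"

instantiation complex :: complex_hilbert_space
begin
definition scaleC_complex :: "complex \<Rightarrow> complex \<Rightarrow> complex"
  where "scaleC_complex c z = c * z"
definition cinner_complex :: "complex \<Rightarrow> complex \<Rightarrow> complex"
  where "cinner_complex w z = cnj w * z"
instance
  by standard
    (auto simp: scaleC_complex_def cinner_complex_def algebra_simps inner_complex_def
      scaleR_conv_of_real)
end

lemma cinner_add_left: "cinner (x + y) z = cinner x z + cinner y (z::'a::complex_hilbert_space)"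
  by (metis cinner_commute cinner_add_right complex_cnj_add)

lemma cinner_scaleC_left: "cinner (c *\<^sub>C x) z = cnj c * cinner x (z::'a::complex_hilbert_space)"
  by (metis cinner_commute cinner_scaleC_right complex_cnj_mult)

lemma cinner_self: "cinner x x = complex_of_real ((norm (x::'a::complex_hilbert_space))\<^sup>2)"
proof -
  have "Im (cinner x x) = 0"
    using cinner_commute[of x x] by (metis add.inverse_neutral cnj.simps(2) equation_minus_iff
        neg_equal_zero)
  then show ?thesis
    by (simp add: complex_eq_iff Re_cinner power2_norm_eq_inner)
qed

lemma norm_scaleC: "norm (c *\<^sub>C (x::'a::complex_hilbert_space)) = cmod c * norm x"
proof -
  have "complex_of_real ((norm (c *\<^sub>C x))\<^sup>2) = c * (cnj c * cinner x x)"
    by (simp only: cinner_self[symmetric] cinner_scaleC_left cinner_scaleC_right)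
  also have "\<dots> = (c * cnj c) * cinner x x"
    by (simp only: mult.assoc)
  also have "\<dots> = complex_of_real ((cmod c * norm x)\<^sup>2)"
    by (simp only: cinner_self complex_norm_square[symmetric] power_mult_distrib of_real_mult of_real_power)
  finally have "(norm (c *\<^sub>C x))\<^sup>2 = (cmod c * norm x)\<^sup>2"
    by (simp only: of_real_eq_iff)
  then show ?thesis by simp
qed

lemma bounded_linear_scaleC:
  "bounded_linear (\<lambda>x::'a::complex_hilbert_space. c *\<^sub>C x)"
proof
  show "c *\<^sub>C (r *\<^sub>R x) = r *\<^sub>R (c *\<^sub>C x)" for r and x :: 'a
    by (simp add: scaleC_scaleC mult.commute flip: scaleC_of_real)
  show "\<exists>K. \<forall>x::'a. norm (c *\<^sub>C x) \<le> norm x * K"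
    by (rule exI[of _ "cmod c"]) (simp add: norm_scaleC mult.commute)
qed (rule scaleC_add_right)

text \<open>The type \<open>'a \<Rightarrow>\<^sub>L 'b\<close> consists of the bounded \<^emph>\<open>real\<close>-linear maps. Complex scalars act on it
  pointwise; complex linearity of individual operators is imposed separately below.\<close>

instantiation blinfun :: (complex_hilbert_space, complex_hilbert_space) complex_vector
begin
lift_definition scaleC_blinfun :: "complex \<Rightarrow> 'a \<Rightarrow>\<^sub>L 'b \<Rightarrow> 'a \<Rightarrow>\<^sub>L 'b"
  is "\<lambda>c A x. c *\<^sub>C A x"
  by (rule bounded_linear_compose[OF bounded_linear_scaleC])
instance
  by standard
    (transfer, simp add: scaleC_add_right scaleC_add_left scaleC_scaleC scaleC_of_real)+
end

definition csubspace :: "'a::complex_vector set \<Rightarrow> bool"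
  where "csubspace V \<longleftrightarrow>
    0 \<in> V \<and> (\<forall>x\<in>V. \<forall>y\<in>V. x + y \<in> V) \<and> (\<forall>c. \<forall>x\<in>V. c *\<^sub>C x \<in> V)"

definition clinear_on :: "'a::complex_vector set \<Rightarrow> ('a \<Rightarrow> 'b::complex_vector) \<Rightarrow> bool"
  where "clinear_on V f \<longleftrightarrow>
    (\<forall>x\<in>V. \<forall>y\<in>V. f (x + y) = f x + f y) \<and> (\<forall>c. \<forall>x\<in>V. f (c *\<^sub>C x) = c *\<^sub>C f x)"


section \<open>Bounded operators\<close>

definition bounded_operators :: "('h::complex_hilbert_space \<Rightarrow>\<^sub>L 'h) set"
  where "bounded_operators = {A. clinear_on UNIV (blinfun_apply A)}"

definition adj :: "('h::complex_hilbert_space \<Rightarrow>\<^sub>L 'h) \<Rightarrow> 'h \<Rightarrow>\<^sub>L 'h"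
  where "adj A = (THE B :: 'h \<Rightarrow>\<^sub>L 'h. \<forall>x y. cinner (A x) y = cinner x (B y))"

text \<open>The description in \<open>adj\<close> determines a unique operator, by the Riesz representation
  theorem, which is proved here for complete real inner product spaces of any dimension.\<close>

lemma riesz_representation:
  fixes f :: "'a::{real_inner,complete_space} \<Rightarrow> real"
  assumes "bounded_linear f"
  obtains z where "\<And>x. f x = inner z x"
proof -
  interpret f: bounded_linear f by fact
  obtain K where K: "\<And>x. norm (f x) \<le> norm x * K" using f.bounded by blast
  define g where "g x = (norm x)\<^sup>2 - 2 * f x" for x
  define I where "I = Inf (range g)"
  have g_low: "- K\<^sup>2 \<le> g x" for x
  proof -
    have "0 \<le> (norm x - K)\<^sup>2" by simp
    then have "2 * (norm x * K) \<le> (norm x)\<^sup>2 + K\<^sup>2" by (simp add: power2_diff)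
    moreover have "f x \<le> norm x * K" using K[of x] by simp
    ultimately show ?thesis by (simp add: g_def)
  qed
  then have bdd: "bdd_below (range g)" by (auto intro!: bdd_belowI)
  then have I_le: "I \<le> g x" for x by (simp add: I_def cInf_lower)
  define \<epsilon> where "\<epsilon> n = 1 / real (Suc n)" for n
  have eps_pos: "0 < \<epsilon> n" for n by (simp add: \<epsilon>_def)
  have "\<exists>x. g x < I + \<epsilon> n" for n
    using cInf_lessD[of "range g" "I + \<epsilon> n"] eps_pos[of n] by (auto simp: I_def)
  then obtain u where u: "\<And>n. g (u n) < I + \<epsilon> n" by metis
  have par: "(norm (x - y))\<^sup>2 \<le> 2 * (g x - I) + 2 * (g y - I)" for x y
  proof -
    have "(norm (x - y))\<^sup>2 = 2 * g x + 2 * g y - 4 * g ((1/2) *\<^sub>R (x + y))"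
      by (simp add: g_def power2_norm_eq_inner f.scaleR f.add inner_commute[of y x] algebra_simps)
    moreover have "4 * I \<le> 4 * g ((1/2) *\<^sub>R (x + y))" using I_le by simp
    ultimately show ?thesis by (simp add: algebra_simps)
  qed
  have "Cauchy u"
  proof (rule metric_CauchyI)
    fix e :: real assume "0 < e"
    then obtain N where N: "\<epsilon> N < e\<^sup>2 / 4"
      using nat_approx_posE[of "e\<^sup>2 / 4"] by (auto simp: \<epsilon>_def)
    have "dist (u m) (u n) < e" if "m \<ge> N" "n \<ge> N" for m n
    proof -
      have "\<epsilon> m \<le> \<epsilon> N" "\<epsilon> n \<le> \<epsilon> N"
        using that by (auto simp: \<epsilon>_def divide_simps)
      with u[of m] u[of n] N have "2 * (g (u m) - I) + 2 * (g (u n) - I) < e\<^sup>2"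
        by (simp add: field_simps)
      with par[of "u m" "u n"] have "(norm (u m - u n))\<^sup>2 < e\<^sup>2" by (rule le_less_trans)
      with \<open>0 < e\<close> show ?thesis by (simp add: dist_norm power2_less_imp_less)
    qed
    then show "\<exists>M. \<forall>m\<ge>M. \<forall>n\<ge>M. dist (u m) (u n) < e" by blast
  qed
  then obtain z where z: "u \<longlonglongrightarrow> z" using Cauchy_convergent convergent_def by blast
  have "(\<lambda>n. g (u n)) \<longlonglongrightarrow> g z"
    unfolding g_def by (intro tendsto_intros f.tendsto z)
  moreover have "(\<lambda>n. I + \<epsilon> n) \<longlonglongrightarrow> I + 0"
    unfolding \<epsilon>_def by (intro tendsto_intros LIMSEQ_Suc lim_1_over_n)
  ultimately have "g z \<le> I"
    using LIMSEQ_le[of "\<lambda>n. g (u n)" "g z" "\<lambda>n. I + \<epsilon> n" I] u less_imp_le by auto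
  then have min: "g z \<le> g x" for x using I_le[of x] by linarith
  have "f h = inner z h" for h
  proof (rule ccontr)
    define d where "d = f h - inner z h"
    assume "f h \<noteq> inner z h"
    then have d: "d \<noteq> 0" by (simp add: d_def)
    then have "h \<noteq> 0" by (auto simp: d_def f.zero)
    then have hp: "0 < inner h h" by simp
    define t where "t = d / inner h h"
    have "g (z + t *\<^sub>R h) = g z + t * t * inner h h - 2 * t * d"
      by (simp add: g_def d_def power2_norm_eq_inner f.add f.scaleR inner_commute[of h z]
          algebra_simps)
    also have "\<dots> = g z - d\<^sup>2 / inner h h"
      using hp by (simp add: t_def power2_eq_square field_simps)
    also have "\<dots> < g z" using d hp by simp
    finally show False using min[of "z + t *\<^sub>R h"] by simp
  qed
  then show thesis using that by blast
qed

lemma ex1_adjoint: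
  fixes A :: "'h::complex_hilbert_space \<Rightarrow>\<^sub>L 'h"
  assumes "A \<in> bounded_operators"
  shows "\<exists>!B :: 'h \<Rightarrow>\<^sub>L 'h. \<forall>x y. cinner (A x) y = cinner x (B y)"
proof -
  have cA: "A (c *\<^sub>C x) = c *\<^sub>C A x" for c x
    using assms by (simp add: bounded_operators_def clinear_on_def)
  have "\<exists>z. \<forall>x. inner y (A x) = inner z x" for y
  proof -
    have "bounded_linear (\<lambda>x. inner y (A x))"
      by (intro bounded_linear_compose[OF bounded_linear_inner_right] blinfun.bounded_linear_right)
    then show ?thesis by (rule riesz_representation) blast
  qed
  then obtain b where b: "\<And>x y. inner y (A x) = inner (b y) x" by metis
  have cb: "cinner (A x) y = cinner x (b y)" for x y
  proof (rule complex_eqI)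
    have re: "Re (cinner (A x) y) = Re (cinner x (b y))" for x
      using b[of y x] by (simp add: Re_cinner inner_commute)
    then show "Re (cinner (A x) y) = Re (cinner x (b y))" .
    have "Re (cinner (A (\<i> *\<^sub>C x)) y) = Re (cinner (\<i> *\<^sub>C x) (b y))" by (rule re)
    then show "Im (cinner (A x) y) = Im (cinner x (b y))"
      by (simp add: cA cinner_scaleC_left)
  qed
  have eqI: "v = w" if "\<And>x. inner v x = inner w x" for v w :: 'h
    using that[of "v - w"] by (metis inner_diff_left inner_eq_zero_iff right_minus_eq)
  have "bounded_linear b"
  proof
    show "b (x + y) = b x + b y" for x y
      by (rule eqI) (simp add: b[symmetric] inner_add_left)
    show "b (r *\<^sub>R x) = r *\<^sub>R b x" for r x
      by (rule eqI) (simp add: b[symmetric])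
    have "norm (b y) \<le> norm y * norm A" for y
    proof (cases "b y = 0")
      case False
      have "norm (b y) * norm (b y) = inner y (A (b y))"
        by (simp add: b flip: power2_norm_eq_inner power2_eq_square)
      also have "\<dots> \<le> norm y * norm (A (b y))" by (rule norm_cauchy_schwarz)
      also have "\<dots> \<le> norm y * (norm A * norm (b y))"
        by (intro mult_left_mono norm_blinfun) simp
      finally show ?thesis using False by (simp add: mult.assoc[symmetric])
    qed simp
    then show "\<exists>K. \<forall>y. norm (b y) \<le> norm y * K" by blast
  qed
  then have "\<forall>x y. cinner (A x) y = cinner x (Blinfun b y)"
    by (simp add: cb bounded_linear_Blinfun_apply)
  moreover have "B = C" if "\<forall>x y. cinner (A x) y = cinner x (B y)"
    "\<forall>x y. cinner (A x) y = cinner x (C y)" for B C :: "'h \<Rightarrow>\<^sub>L 'h"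
  proof (rule blinfun_eqI, rule eqI)
    fix x y
    show "inner (B y) x = inner (C y) x"
      using that by (metis Re_cinner inner_commute)
  qed
  ultimately show ?thesis by blast
qed

lemma cinner_adj: "A \<in> bounded_operators \<Longrightarrow> cinner (A x) y = cinner x (adj A y)"
  using theI'[OF ex1_adjoint[of A]] unfolding adj_def by blast

definition positive :: "('h::complex_hilbert_space \<Rightarrow>\<^sub>L 'h) \<Rightarrow> bool"
  where "positive A \<longleftrightarrow> A \<in> bounded_operators \<and> (\<forall>x. cinner x (A x) \<in> \<real>\<^sub>\<ge>\<^sub>0)"

definition op_le :: "('h::complex_hilbert_space \<Rightarrow>\<^sub>L 'h) \<Rightarrow> ('h \<Rightarrow>\<^sub>L 'h) \<Rightarrow> bool"
  where "op_le A B \<longleftrightarrow> positive (B - A)"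

text \<open>Positivity of the operator matrix \<open>(a i j)\<close>, \<open>i, j < n\<close>, on the direct sum of
  \<open>n\<close> copies of the Hilbert space.\<close>

definition positive_matrix :: "nat \<Rightarrow> (nat \<Rightarrow> nat \<Rightarrow> 'h::complex_hilbert_space \<Rightarrow>\<^sub>L 'h) \<Rightarrow> bool"
  where "positive_matrix n a \<longleftrightarrow>
    (\<forall>i<n. \<forall>j<n. a i j \<in> bounded_operators) \<and>
    (\<forall>x. (\<Sum>i<n. \<Sum>j<n. cinner (x i) (a i j (x j))) \<in> \<real>\<^sub>\<ge>\<^sub>0)"


section \<open>Von Neumann algebras, states and conditional expectations\<close>

definition von_neumann_algebra :: "('h::complex_hilbert_space \<Rightarrow>\<^sub>L 'h) set \<Rightarrow> bool"
  where "von_neumann_algebra M \<longleftrightarrow>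
    M \<subseteq> bounded_operators \<and> csubspace M \<and> id_blinfun \<in> M \<and>
    (\<forall>A\<in>M. \<forall>B\<in>M. A o\<^sub>L B \<in> M) \<and> (\<forall>A\<in>M. adj A \<in> M) \<and>
    closedin strong_operator_topology M"

definition abelian :: "('h::complex_hilbert_space \<Rightarrow>\<^sub>L 'h) set \<Rightarrow> bool"
  where "abelian N \<longleftrightarrow> (\<forall>A\<in>N. \<forall>B\<in>N. A o\<^sub>L B = B o\<^sub>L A)"

definition self_adjoint_part :: "('h::complex_hilbert_space \<Rightarrow>\<^sub>L 'h) set \<Rightarrow> ('h \<Rightarrow>\<^sub>L 'h) set"
  where "self_adjoint_part M = {A \<in> M. adj A = A}"

definition directed :: "('h::complex_hilbert_space \<Rightarrow>\<^sub>L 'h) set \<Rightarrow> bool"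
  where "directed D \<longleftrightarrow> D \<noteq> {} \<and> (\<forall>A\<in>D. \<forall>B\<in>D. \<exists>C\<in>D. op_le A C \<and> op_le B C)"

definition is_lub_in ::
    "('h::complex_hilbert_space \<Rightarrow>\<^sub>L 'h) set \<Rightarrow> ('h \<Rightarrow>\<^sub>L 'h) set \<Rightarrow> ('h \<Rightarrow>\<^sub>L 'h) \<Rightarrow> bool"
  where "is_lub_in M D S \<longleftrightarrow>
    S \<in> self_adjoint_part M \<and> (\<forall>A\<in>D. op_le A S) \<and>
    (\<forall>U\<in>self_adjoint_part M. (\<forall>A\<in>D. op_le A U) \<longrightarrow> op_le S U)"

text \<open>Normality, for functionals and for maps, is preservation of suprema of bounded increasing
  nets of self-adjoint elements. Such nets are given here as directed sets; having a
  supremum includes being bounded above.\<close>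

definition state :: "('h::complex_hilbert_space \<Rightarrow>\<^sub>L 'h) set \<Rightarrow> (('h \<Rightarrow>\<^sub>L 'h) \<Rightarrow> complex) \<Rightarrow> bool"
  where "state M \<phi> \<longleftrightarrow>
    clinear_on M \<phi> \<and> (\<forall>A\<in>M. positive A \<longrightarrow> \<phi> A \<in> \<real>\<^sub>\<ge>\<^sub>0) \<and> \<phi> id_blinfun = 1"

definition normal_functional ::
    "('h::complex_hilbert_space \<Rightarrow>\<^sub>L 'h) set \<Rightarrow> (('h \<Rightarrow>\<^sub>L 'h) \<Rightarrow> complex) \<Rightarrow> bool"
  where "normal_functional M \<phi> \<longleftrightarrow>
    (\<forall>D S. D \<subseteq> self_adjoint_part M \<and> directed D \<and> is_lub_in M D S \<longrightarrow>
      Re (\<phi> S) = (SUP A\<in>D. Re (\<phi> A)))"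

definition faithful :: "('h::complex_hilbert_space \<Rightarrow>\<^sub>L 'h) set \<Rightarrow> (('h \<Rightarrow>\<^sub>L 'h) \<Rightarrow> complex) \<Rightarrow> bool"
  where "faithful M \<phi> \<longleftrightarrow> (\<forall>A\<in>M. \<phi> (adj A o\<^sub>L A) = 0 \<longrightarrow> A = 0)"

definition normal_map ::
    "('h::complex_hilbert_space \<Rightarrow>\<^sub>L 'h) set \<Rightarrow> ('h \<Rightarrow>\<^sub>L 'h) set
      \<Rightarrow> (('h \<Rightarrow>\<^sub>L 'h) \<Rightarrow> ('h \<Rightarrow>\<^sub>L 'h)) \<Rightarrow> bool"
  where "normal_map M N E \<longleftrightarrow>
    (\<forall>D S. D \<subseteq> self_adjoint_part M \<and> directed D \<and> is_lub_in M D S \<longrightarrow>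
      is_lub_in N (E ` D) (E S))"

definition completely_positive ::
    "('h::complex_hilbert_space \<Rightarrow>\<^sub>L 'h) set \<Rightarrow> (('h \<Rightarrow>\<^sub>L 'h) \<Rightarrow> ('h \<Rightarrow>\<^sub>L 'h)) \<Rightarrow> bool"
  where "completely_positive M E \<longleftrightarrow>
    (\<forall>n a. (\<forall>i<n. \<forall>j<n. a i j \<in> M) \<and> positive_matrix n a \<longrightarrow>
      positive_matrix n (\<lambda>i j. E (a i j)))"

definition conditional_expectation ::
    "('h::complex_hilbert_space \<Rightarrow>\<^sub>L 'h) set \<Rightarrow> ('h \<Rightarrow>\<^sub>L 'h) set
      \<Rightarrow> (('h \<Rightarrow>\<^sub>L 'h) \<Rightarrow> ('h \<Rightarrow>\<^sub>L 'h)) \<Rightarrow> bool"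
  where "conditional_expectation M N E \<longleftrightarrow>
    clinear_on M E \<and> E id_blinfun = id_blinfun \<and> completely_positive M E \<and>
    (\<forall>X\<in>M. E (E X) = E X) \<and> E ` M = N \<and>
    (\<forall>a\<in>N. \<forall>b\<in>N. \<forall>X\<in>M. E (a o\<^sub>L X o\<^sub>L b) = a o\<^sub>L E X o\<^sub>L b)"

definition preserves_state ::
    "('h::complex_hilbert_space \<Rightarrow>\<^sub>L 'h) set \<Rightarrow> (('h \<Rightarrow>\<^sub>L 'h) \<Rightarrow> complex)
      \<Rightarrow> (('h \<Rightarrow>\<^sub>L 'h) \<Rightarrow> ('h \<Rightarrow>\<^sub>L 'h)) \<Rightarrow> bool"
  where "preserves_state M \<phi> E \<longleftrightarrow> (\<forall>X\<in>M. \<phi> (E X) = \<phi> X)"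


section \<open>The Hilbert space completion and extensions to it\<close>

definition state_inner ::
    "(('h::complex_hilbert_space \<Rightarrow>\<^sub>L 'h) \<Rightarrow> complex) \<Rightarrow> ('h \<Rightarrow>\<^sub>L 'h) \<Rightarrow> ('h \<Rightarrow>\<^sub>L 'h) \<Rightarrow> complex"
  where "state_inner \<phi> X Y = \<phi> (adj X o\<^sub>L Y)"

text \<open>A Hilbert space completion of \<open>M\<close> in the norm of \<open>state_inner \<phi>\<close>: a complex Hilbert space,
  which is all of the type \<open>'k\<close>, with a linear map \<open>\<Lambda>\<close> of \<open>M\<close> onto a dense subspace that
  preserves inner products. It is determined up to a unique unitary compatible with \<open>\<Lambda>\<close>.
  Since a type cannot depend on \<open>M\<close> and \<open>\<phi>\<close>, the pair of \<open>'k\<close> and \<open>\<Lambda>\<close> is a parameter.\<close>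

definition hilbert_completion ::
    "('h::complex_hilbert_space \<Rightarrow>\<^sub>L 'h) set \<Rightarrow> (('h \<Rightarrow>\<^sub>L 'h) \<Rightarrow> complex)
      \<Rightarrow> (('h \<Rightarrow>\<^sub>L 'h) \<Rightarrow> 'k::complex_hilbert_space) \<Rightarrow> bool"
  where "hilbert_completion M \<phi> \<Lambda> \<longleftrightarrow>
    clinear_on M \<Lambda> \<and> (\<forall>X\<in>M. \<forall>Y\<in>M. cinner (\<Lambda> X) (\<Lambda> Y) = state_inner \<phi> X Y) \<and>
    closure (\<Lambda> ` M) = UNIV"

definition generated_closed_subspace :: "'k::complex_hilbert_space set \<Rightarrow> 'k set"
  where "generated_closed_subspace S = (\<lambda>V. csubspace V \<and> closed V) hull S"

definition is_bounded_extension ::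
    "('h::complex_hilbert_space \<Rightarrow>\<^sub>L 'h) set \<Rightarrow> (('h \<Rightarrow>\<^sub>L 'h) \<Rightarrow> 'k::complex_hilbert_space)
      \<Rightarrow> (('h \<Rightarrow>\<^sub>L 'h) \<Rightarrow> ('h \<Rightarrow>\<^sub>L 'h)) \<Rightarrow> ('k \<Rightarrow>\<^sub>L 'k) \<Rightarrow> bool"
  where "is_bounded_extension M \<Lambda> E T \<longleftrightarrow>
    T \<in> bounded_operators \<and> (\<forall>X\<in>M. T (\<Lambda> X) = \<Lambda> (E X))"

definition bounded_extension ::
    "('h::complex_hilbert_space \<Rightarrow>\<^sub>L 'h) set \<Rightarrow> (('h \<Rightarrow>\<^sub>L 'h) \<Rightarrow> 'k::complex_hilbert_space)
      \<Rightarrow> (('h \<Rightarrow>\<^sub>L 'h) \<Rightarrow> ('h \<Rightarrow>\<^sub>L 'h)) \<Rightarrow> 'k \<Rightarrow>\<^sub>L 'k"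
  where "bounded_extension M \<Lambda> E = (THE T. is_bounded_extension M \<Lambda> E T)"

definition orthogonal_projection_onto ::
    "'k::complex_hilbert_space set \<Rightarrow> ('k \<Rightarrow>\<^sub>L 'k) \<Rightarrow> bool"
  where "orthogonal_projection_onto V P \<longleftrightarrow>
    P \<in> bounded_operators \<and> P o\<^sub>L P = P \<and> adj P = P \<and> range (blinfun_apply P) = V"

end

theory Submission
  imports Defs
begin

text \<open>Bimodularity and invariance of the state give \<open>\<phi> (A\<^sup>* X) = \<phi> (E (A\<^sup>* X)) = \<phi> (A\<^sup>* E X)\<close> for
  \<open>A \<in> N\<close> and \<open>X \<in> M\<close>, so \<open>\<Lambda> (E X)\<close> is the orthogonal projection of \<open>\<Lambda> X\<close> onto the closed subspace
  generated by \<open>\<Lambda> ` N\<close>. Since orthogonal projections are contractive and the space is complete,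
  vectors that have a projection onto a given closed subspace form a closed set; as this
  set contains the dense set \<open>\<Lambda> ` M\<close>, it is the whole space.\<close>

lemma cinner_minus_right: "cinner x (- y) = - cinner x (y :: 'a::complex_hilbert_space)"
  using cinner_scaleC_right[of x "-1" y] scaleC_of_real[of "-1" y] by simp

lemma cinner_diff_right: "cinner x (y - z) = cinner x y - cinner x (z :: 'a::complex_hilbert_space)"
  using cinner_add_right[of x y "- z"] by (simp add: cinner_minus_right)

lemma cinner_eq_0_commute: "cinner x y = 0 \<longleftrightarrow> cinner y (x :: 'a::complex_hilbert_space) = 0"
  by (metis cinner_commute complex_cnj_zero)

lemma cinner_zero_right [simp]: "cinner x (0 :: 'a::complex_hilbert_space) = 0"
  using cinner_diff_right[of x 0 0] by simp

lemma cinner_zero_left [simp]: "cinner 0 (x :: 'a::complex_hilbert_space) = 0"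
  by (simp add: cinner_eq_0_commute[of 0])

text \<open>Both components reduce to the real inner product: linearity in the second argument turns
  the imaginary part into minus the real part at \<open>\<i> *\<^sub>C y\<close>.\<close>

lemma continuous_on_cinner_right:
  "continuous_on S (\<lambda>y. cinner (x :: 'a::complex_hilbert_space) y)"
proof -
  have "cinner x y = Complex (inner x y) (- inner x (\<i> *\<^sub>C y))" for y
    using Re_cinner[of x "\<i> *\<^sub>C y"] by (simp add: complex_eq_iff Re_cinner cinner_scaleC_right)
  moreover have "continuous_on S (\<lambda>y. Complex (inner x y) (- inner x (\<i> *\<^sub>C y)))"
    unfolding Complex_eq by (intro continuous_intros bounded_linear.continuous_on[OF bounded_linear_scaleC])
  ultimately show ?thesis by simp
qed

lemma csubspace_diff: "csubspace V \<Longrightarrow> x \<in> V \<Longrightarrow> y \<in> V \<Longrightarrow> x - y \<in> V"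
  unfolding csubspace_def
  by (metis diff_conv_add_uminus of_real_1 of_real_minus scaleC_of_real scaleR_minus1_left)

lemma csubspace_orthogonal: "csubspace {v. cinner (z :: 'a::complex_hilbert_space) v = 0}"
  by (simp add: csubspace_def cinner_add_right cinner_scaleC_right)

lemma closed_orthogonal: "closed {v. cinner (z :: 'a::complex_hilbert_space) v = 0}"
  by (intro closed_Collect_eq continuous_on_cinner_right continuous_on_const)

lemma csubspace_generated_closed_subspace: "csubspace (generated_closed_subspace S)"
  by (auto simp: generated_closed_subspace_def hull_def csubspace_def)

lemma closed_generated_closed_subspace: "closed (generated_closed_subspace S)"
  by (auto simp: generated_closed_subspace_def hull_def intro!: closed_Inter)

lemma generated_closed_subspace_superset: "S \<subseteq> generated_closed_subspace S"
  by (simp add: generated_closed_subspace_def hull_subset)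

text \<open>The vectors orthogonal to \<open>z\<close> form a closed complex subspace, so by
  minimality of the hull it suffices to test orthogonality on generators.\<close>

lemma orthogonal_generated_closed_subspace:
  assumes "\<And>s. s \<in> S \<Longrightarrow> cinner s z = 0" and "v \<in> generated_closed_subspace S"
  shows "cinner v z = 0"
proof -
  have "generated_closed_subspace S \<subseteq> {v. cinner z v = 0}"
    unfolding generated_closed_subspace_def
  proof (intro hull_minimal conjI csubspace_orthogonal closed_orthogonal subsetI CollectI)
    show "cinner z s = 0" if "s \<in> S" for s
      using assms(1)[OF that] by (subst cinner_eq_0_commute)
  qed
  with assms(2) show ?thesis by (auto simp: cinner_eq_0_commute[of v])
qed

text \<open>A relation rather than a function, so that single vectors can be treated before every
  vector is known to have a projection.\<close>

definition is_projection_of :: "'k::complex_hilbert_space set \<Rightarrow> 'k \<Rightarrow> 'k \<Rightarrow> bool"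
  where "is_projection_of V x y \<longleftrightarrow> y \<in> V \<and> (\<forall>v\<in>V. cinner v (x - y) = 0)"

lemma is_projection_of_add:
  assumes "csubspace V" "is_projection_of V x y" "is_projection_of V x' y'"
  shows "is_projection_of V (x + x') (y + y')"
  using assms by (simp add: is_projection_of_def csubspace_def cinner_add_right cinner_diff_right)

lemma is_projection_of_scaleC:
  assumes "csubspace V" "is_projection_of V x y"
  shows "is_projection_of V (c *\<^sub>C x) (c *\<^sub>C y)"
  using assms by (simp add: is_projection_of_def csubspace_def cinner_scaleC_right cinner_diff_right)

lemma is_projection_of_diff:
  assumes "csubspace V" "is_projection_of V x y" "is_projection_of V x' y'"
  shows "is_projection_of V (x - x') (y - y')"
  using assms by (simp add: is_projection_of_def csubspace_diff cinner_diff_right)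

text \<open>Since \<open>y\<close> itself lies in \<open>V\<close>, it is orthogonal to
  \<open>x - y\<close>; hence the square of its norm is \<open>inner y x\<close>, and Cauchy-Schwarz
  applies.\<close>

lemma is_projection_of_norm_le:
  assumes "is_projection_of V x y"
  shows "norm y \<le> norm x"
proof (cases "y = 0")
  case False
  have "inner y (x - y) = 0"
    using assms by (metis Re_cinner is_projection_of_def zero_complex.sel(1))
  then have "norm y * norm y = inner y x"
    by (simp add: inner_diff_right flip: power2_norm_eq_inner power2_eq_square)
  also have "\<dots> \<le> norm y * norm x" by (rule norm_cauchy_schwarz)
  finally show ?thesis using False by simp
qed simp

text \<open>The difference \<open>y - y'\<close> is a projection of \<open>x - x\<close>, that is of
  0, and contractivity makes it vanish.\<close>

lemma is_projection_of_unique: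
  assumes "csubspace V" "is_projection_of V x y" "is_projection_of V x y'"
  shows "y = y'"
  using is_projection_of_norm_le[OF is_projection_of_diff[OF assms]] by simp

lemma closed_has_projection:
  fixes V :: "'k::complex_hilbert_space set"
  assumes V: "csubspace V" "closed V"
  shows "closed {x. \<exists>y. is_projection_of V x y}"
  unfolding closed_sequential_limits
proof (intro allI impI, elim conjE)
  fix u :: "nat \<Rightarrow> 'k" and x
  assume "\<forall>n. u n \<in> {x. \<exists>y. is_projection_of V x y}" and u: "u \<longlonglongrightarrow> x"
  then obtain w where w: "\<And>n. is_projection_of V (u n) (w n)" by auto metis
  \<comment> \<open>Contractivity on differences carries the Cauchy property from the vectors to
    their projections.\<close>
  have "norm (w m - w n) \<le> norm (u m - u n)" for m n
    by (rule is_projection_of_norm_le[OF is_projection_of_diff[OF V(1) w w]])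
  then have "Cauchy w"
    using LIMSEQ_imp_Cauchy[OF u] unfolding Cauchy_def dist_norm by (meson le_less_trans)
  then obtain y where y: "w \<longlonglongrightarrow> y" using Cauchy_convergent convergent_def by blast
  have "y \<in> V"
    using closed_sequentially[OF V(2) _ y] w by (simp add: is_projection_of_def)
  \<comment> \<open>The differences \<open>u n - w n\<close> are orthogonal to \<open>v\<close> and
    tend to \<open>x - y\<close>; the orthogonal complement of \<open>v\<close> is closed.\<close>
  moreover have "cinner v (x - y) = 0" if "v \<in> V" for v
    using closed_sequentially[OF closed_orthogonal _ tendsto_diff[OF u y], of v] w that
    by (simp add: is_projection_of_def)
  ultimately show "x \<in> {x. \<exists>y. is_projection_of V x y}" by (auto simp: is_projection_of_def)
qed

lemma orthogonal_projection_onto_exists: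
  fixes V :: "'k::complex_hilbert_space set"
  assumes V: "csubspace V" "closed V"
    and dense: "closure D = UNIV" and D: "\<And>x. x \<in> D \<Longrightarrow> \<exists>y. is_projection_of V x y"
  obtains P where "orthogonal_projection_onto V P" "\<And>x. is_projection_of V x (P x)"
proof -
  have "UNIV \<subseteq> {x. \<exists>y. is_projection_of V x y}"
    unfolding dense[symmetric] using D by (intro closure_minimal closed_has_projection V) auto
  then obtain p where p: "\<And>x. is_projection_of V x (p x)" by (auto simp: subset_eq) metis
  \<comment> \<open>Uniqueness drives the algebra of \<open>p\<close>: to identify
    \<open>p x\<close> with a candidate, check that the candidate is a projection of
    \<open>x\<close>.\<close>
  note p_eq = is_projection_of_unique[OF V(1) p]
  have p_scaleC: "p (c *\<^sub>C x) = c *\<^sub>C p x" for c x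
    by (rule p_eq) (intro is_projection_of_scaleC V p)
  have "bounded_linear p"
  proof
    show "p (x + y) = p x + p y" for x y
      by (rule p_eq) (intro is_projection_of_add V p)
    show "p (r *\<^sub>R x) = r *\<^sub>R p x" for r x
      by (simp add: p_scaleC flip: scaleC_of_real)
    show "\<exists>K. \<forall>x. norm (p x) \<le> norm x * K"
      using is_projection_of_norm_le[OF p] by (intro exI[of _ 1]) simp
  qed
  define P where "P = Blinfun p"
  have P_apply: "blinfun_apply P = p"
    unfolding P_def by (rule bounded_linear_Blinfun_apply) fact
  have P: "P \<in> bounded_operators"
    by (simp add: bounded_operators_def clinear_on_def P_apply[symmetric] p_scaleC blinfun.add_right)
      (simp add: P_apply p_scaleC)
  have p_id: "p v = v" if "v \<in> V" for v
    using that by (intro p_eq) (simp add: is_projection_of_def)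
  have p_in: "p x \<in> V" for x using p[of x] by (simp add: is_projection_of_def)
  have orth: "cinner (p x) (y - p y) = 0" for x y
    using p[of y] p_in[of x] by (simp add: is_projection_of_def)
  \<comment> \<open>Self-adjointness: by \<open>orth\<close>, used once in each order of
    \<open>x\<close> and \<open>y\<close>, both sides equal
    \<open>cinner (p x) (p y)\<close>.\<close>
  have "cinner (p x) y = cinner x (p y)" for x y
  proof -
    have "cinner (p x) y = cinner (p x) (p y)" using orth[of x y] by (simp add: cinner_diff_right)
    also have "\<dots> = cnj (cinner (p y) (p x))" by (rule cinner_commute)
    also have "cinner (p y) (p x) = cinner (p y) x" using orth[of y x] by (simp add: cinner_diff_right)
    also have "cnj \<dots> = cinner x (p y)" by (rule cinner_commute[symmetric])
    finally show ?thesis .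
  qed
  then have "adj P = P"
    unfolding adj_def by (intro the1_equality ex1_adjoint P) (simp add: P_apply)
  moreover have "P o\<^sub>L P = P"
    by (rule blinfun_eqI) (simp add: P_apply p_id p_in)
  moreover have "range (blinfun_apply P) = V"
    using p_id p_in by (auto simp: P_apply) (metis rangeI)
  ultimately show thesis
    using that[of P] P p by (simp add: orthogonal_projection_onto_def P_apply)
qed

text \<open>The set where two continuous maps agree is closed, and here it contains the dense image
  of \<open>M\<close>.\<close>

lemma is_bounded_extension_unique:
  assumes "hilbert_completion M \<phi> \<Lambda>"
    and "is_bounded_extension M \<Lambda> E S" "is_bounded_extension M \<Lambda> E T"
  shows "S = T"
proof (rule blinfun_eqI)
  fix x
  have "closed {x. S x = T x}"
    by (intro closed_Collect_eq continuous_intros)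
  then have "closure (\<Lambda> ` M) \<subseteq> {x. S x = T x}"
    using assms(2,3) by (intro closure_minimal) (auto simp: is_bounded_extension_def)
  then show "S x = T x" using assms(1) by (auto simp: hilbert_completion_def)
qed

lemma state_inner_conditional_expectation:
  assumes "von_neumann_algebra M" "von_neumann_algebra N" "N \<subseteq> M"
    and "conditional_expectation M N E" "preserves_state M \<phi> E"
    and "A \<in> N" "X \<in> M"
  shows "state_inner \<phi> A (E X) = state_inner \<phi> A X"
proof -
  have "adj A \<in> N" "id_blinfun \<in> N"
    using assms(2,6) by (auto simp: von_neumann_algebra_def)
  \<comment> \<open>Bimodularity is two-sided; taking the identity of \<open>N\<close> as the right
    factor leaves left multiplication by \<open>adj A\<close>.\<close>
  then have "E (adj A o\<^sub>L X o\<^sub>L id_blinfun) = adj A o\<^sub>L E X o\<^sub>L id_blinfun"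
    using assms(4,7) unfolding conditional_expectation_def by blast
  moreover have "B o\<^sub>L id_blinfun = B" for B :: "'a \<Rightarrow>\<^sub>L 'a"
    by (rule blinfun_eqI) simp
  moreover have "adj A o\<^sub>L X \<in> M"
    using assms(1,3,7) \<open>adj A \<in> N\<close> by (auto simp: von_neumann_algebra_def)
  ultimately show ?thesis
    using assms(5) unfolding state_inner_def preserves_state_def by metis
qed

lemma is_projection_of_conditional_expectation:
  assumes "von_neumann_algebra M" "von_neumann_algebra N" "N \<subseteq> M"
    and "conditional_expectation M N E" "preserves_state M \<phi> E" "hilbert_completion M \<phi> \<Lambda>"
    and "X \<in> M"
  shows "is_projection_of (generated_closed_subspace (\<Lambda> ` N)) (\<Lambda> X) (\<Lambda> (E X))"
proof -
  have EX: "E X \<in> N"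
    using assms(4,7) by (auto simp: conditional_expectation_def)
  \<comment> \<open>Orthogonality is checked on the generators first, where \<Lambda> turns it into
    an identity for the state.\<close>
  have "cinner (\<Lambda> A) (\<Lambda> X - \<Lambda> (E X)) = 0" if "A \<in> N" for A
  proof -
    have "A \<in> M" "E X \<in> M" using assms(3) EX that by auto
    then show ?thesis
      using assms(6,7) state_inner_conditional_expectation[OF assms(1-5) that assms(7)]
      by (simp add: cinner_diff_right hilbert_completion_def)
  qed
  then have "cinner v (\<Lambda> X - \<Lambda> (E X)) = 0" if "v \<in> generated_closed_subspace (\<Lambda> ` N)" for v
    by (intro orthogonal_generated_closed_subspace[OF _ that]) auto
  then show ?thesis
    using EX generated_closed_subspace_superset[of "\<Lambda> ` N"]
    by (auto simp: is_projection_of_def)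
qed

theorem theorem4p4:
  fixes M N :: "('h::complex_hilbert_space \<Rightarrow>\<^sub>L 'h) set"
    and \<phi> :: "('h \<Rightarrow>\<^sub>L 'h) \<Rightarrow> complex"
    and E :: "('h \<Rightarrow>\<^sub>L 'h) \<Rightarrow> ('h \<Rightarrow>\<^sub>L 'h)"
    and \<Lambda> :: "('h \<Rightarrow>\<^sub>L 'h) \<Rightarrow> 'k::complex_hilbert_space"
  assumes "von_neumann_algebra M"
    and "state M \<phi>" and "normal_functional M \<phi>" and "faithful M \<phi>"
    and "von_neumann_algebra N" and "N \<subseteq> M" and "abelian N"
    and "conditional_expectation M N E" and "normal_map M N E" and "preserves_state M \<phi> E"
    and "hilbert_completion M \<phi> \<Lambda>"
  shows "(\<exists>!T. is_bounded_extension M \<Lambda> E T) \<and>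
    orthogonal_projection_onto (generated_closed_subspace (\<Lambda> ` N)) (bounded_extension M \<Lambda> E) \<and>
    (\<forall>X. \<forall>A \<in> generated_closed_subspace (\<Lambda> ` N).
      cinner (X - bounded_extension M \<Lambda> E X) A = 0)"
proof -
  let ?V = "generated_closed_subspace (\<Lambda> ` N)"
  note V = csubspace_generated_closed_subspace[of "\<Lambda> ` N"]
    closed_generated_closed_subspace[of "\<Lambda> ` N"]
  note proj = is_projection_of_conditional_expectation[OF assms(1,5,6,8,10,11)]
  have "closure (\<Lambda> ` M) = UNIV" using assms(11) by (simp add: hilbert_completion_def)
  then obtain P where P: "orthogonal_projection_onto ?V P"
    and is_proj: "\<And>x. is_projection_of ?V x (P x)"
    using orthogonal_projection_onto_exists[OF V, of "\<Lambda> ` M"] proj by blast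
  \<comment> \<open>Existence of the extension comes from the projection:
    \<open>P (\<Lambda> X)\<close> and \<open>\<Lambda> (E X)\<close> are both projections of
    \<open>\<Lambda> X\<close>, hence equal.\<close>
  have ext: "is_bounded_extension M \<Lambda> E P"
    using P is_projection_of_unique[OF V(1) is_proj proj]
    by (simp add: is_bounded_extension_def orthogonal_projection_onto_def)
  then have ex1: "\<exists>!T. is_bounded_extension M \<Lambda> E T"
    using is_bounded_extension_unique[OF assms(11)] by blast
  then have "bounded_extension M \<Lambda> E = P"
    unfolding bounded_extension_def using ext by (rule the1_equality)
  \<comment> \<open>The claim has the difference in the first argument,
    \<open>is_projection_of\<close> in the second; vanishing is symmetric.\<close>
  with ex1 P is_proj show ?thesis
    by (simp add: is_projection_of_def cinner_eq_0_commute[of "_ - _"])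
qed

end
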